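(* Let $m_0\in\mathbb{C}$ be such that $q^{2m_0+k}\neq -1$ for all $k\in\mathbb{Z}$. Let $\ell\in\mathbb{C}$ be such that $[\ell+m+1]\neq 0$ and $[\ell-m]\neq 0$ for all $m\in m_0+\mathbb{Z}$. Then the representation $V_{m_0}^{\ell}$ of $U_q^{\mathrm{tw}}(\mathfrak{so}_3)$ is irreducible.
   Context: Fix $h\in\mathbb{C}\setminus 2\pi i\mathbb{Q}$, where $i=\sqrt{-1}$, and put $q=\exp(h)$, so $q$ is not a root of unity. For $b\in\mathbb{C}$ put $q^b=\exp(hb)$ and $[b]=\frac{q^b-q^{-b}}{q-q^{-1}}$. The algebra $U_q^{\mathrm{tw}}(\mathfrak{so}_3)$ is the complex unital associative algebra generated by $I_{21},I_{32}$ subject to $$I_{32}^2I_{21}-[2]I_{32}I_{21}I_{32}+I_{21}I_{32}^2=-I_{21},\qquad I_{21}^2I_{32}-[2]I_{21}I_{32}I_{21}+I_{32}I_{21}^2=-I_{32}.$$ For $\ell,m_0\in\mathbb{C}$ with $q^{2m}\neq -1$ for all $m\in m_0+\mathbb{Z}$, $V_{m_0}^{\ell}=\bigoplus_{m\in m_0+\mathbb{Z}}\mathbb{C}\,|m\rangle$ is the representation of $U_q^{\mathrm{tw}}(\mathfrak{so}_3)$ with basis $\{|m\rangle : m\in m_0+\mathbb{Z}\}$ and action $$I_{21}.|m\rangle=i[m]\,|m\rangle,\qquad I_{32}.|m\rangle=\frac{[\ell+m+1][\ell-m]}{(q^{m}+q^{-m})(q^{m+1}+q^{-m-1})}\,|m+1\rangle-|m-1\rangle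 .$$ *)

theory Defs
  imports Complex_Main "HOL-Library.Poly_Mapping" "HOL-Algebra.QuotRing" "HOL-Algebra.Module"
begin

section \<open>Formal linear combinations\<close>

definition scl :: "complex \<Rightarrow> ('k \<Rightarrow>\<^sub>0 complex) \<Rightarrow> ('k \<Rightarrow>\<^sub>0 complex)" where
  "scl c v = Poly_Mapping.map ((*) c) v"

abbreviation ket :: "'k \<Rightarrow> ('k \<Rightarrow>\<^sub>0 complex)" where
  "ket k \<equiv> Poly_Mapping.single k 1"

definition lin_ext :: "('k \<Rightarrow> ('j \<Rightarrow>\<^sub>0 complex)) \<Rightarrow> ('k \<Rightarrow>\<^sub>0 complex) \<Rightarrow> ('j \<Rightarrow>\<^sub>0 complex)" where
  "lin_ext f v = (\<Sum>k\<in>Poly_Mapping.keys v. scl (Poly_Mapping.lookup v k) (f k))"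

section \<open>Algebras given by generators and relations\<close>

text \<open>A complex algebra is a record of type \<open>(complex, 'a) module\<close>, that is, a ring
  together with a scalar multiplication. The wrapper \<open>word\<close> makes lists the free monoid,
  so that \<open>'g word \<Rightarrow>\<^sub>0 complex\<close> with the convolution product is the free
  unital algebra on \<open>'g\<close>.\<close>

datatype 'g word = Word (letters: "'g list")

instantiation word :: (type) monoid_add
begin

definition zero_word :: "'a word" where
  "zero_word = Word []"

definition plus_word :: "'a word \<Rightarrow> 'a word \<Rightarrow> 'a word" where
  "plus_word u w = Word (letters u @ letters w)"

instance
  by standard (simp_all add: zero_word_def plus_word_def)

end

type_synonym 'g free = "'g word \<Rightarrow>\<^sub>0 complex"

definition free_alg :: "(complex, 'g free) module" where
  "free_alg = \<lparr>carrier = UNIV, mult = (*), one = 1, zero = 0, add = (+), smult = scl\<rparr>"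

text \<open>The ring structure of the quotient is that of \<open>Quot\<close>. Its scalar multiplication
  is written in the style of \<open>rcoset_mult\<close>.\<close>

definition quot_alg :: "(complex, 'a) module \<Rightarrow> 'a set \<Rightarrow> (complex, 'a set) module" where
  "quot_alg A J = ring.extend (A Quot J)
     (module.fields (\<lambda>c X. \<Union>x\<in>X. J +>\<^bsub>A\<^esub> (c \<odot>\<^bsub>A\<^esub> x)))"

text \<open>Relations are given by relators, i.e. elements which become zero; \<open>genideal\<close>
  generates two-sided ideals.\<close>

definition presented_alg :: "'g free set \<Rightarrow> (complex, 'g free set) module" where
  "presented_alg R = quot_alg free_alg (genideal free_alg R)"

section \<open>Irreducible representations\<close>

definition representation ::
  "(complex, 'a) module \<Rightarrow> (complex \<Rightarrow> 'v \<Rightarrow> 'v) \<Rightarrow> 'v::ab_group_add set \<Rightarrow> ('a \<Rightarrow> 'v \<Rightarrow> 'v) \<Rightarrow> bool"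
where
  "representation A s V \<rho> \<longleftrightarrow>
     vector_space s \<and> module.subspace s V \<and>
     (\<forall>a\<in>carrier A. \<forall>v\<in>V. \<rho> a v \<in> V) \<and>
     (\<forall>a\<in>carrier A. \<forall>v\<in>V. \<forall>w\<in>V. \<rho> a (v + w) = \<rho> a v + \<rho> a w) \<and>
     (\<forall>a\<in>carrier A. \<forall>c. \<forall>v\<in>V. \<rho> a (s c v) = s c (\<rho> a v)) \<and>
     (\<forall>a\<in>carrier A. \<forall>b\<in>carrier A. \<forall>v\<in>V. \<rho> (a \<oplus>\<^bsub>A\<^esub> b) v = \<rho> a v + \<rho> b v) \<and>
     (\<forall>c. \<forall>a\<in>carrier A. \<forall>v\<in>V. \<rho> (c \<odot>\<^bsub>A\<^esub> a) v = s c (\<rho> a v)) \<and>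
     (\<forall>a\<in>carrier A. \<forall>b\<in>carrier A. \<forall>v\<in>V. \<rho> (a \<otimes>\<^bsub>A\<^esub> b) v = \<rho> a (\<rho> b v)) \<and>
     (\<forall>v\<in>V. \<rho> \<one>\<^bsub>A\<^esub> v = v)"

definition irreducible_representation ::
  "(complex, 'a) module \<Rightarrow> (complex \<Rightarrow> 'v \<Rightarrow> 'v) \<Rightarrow> 'v::ab_group_add set \<Rightarrow> ('a \<Rightarrow> 'v \<Rightarrow> 'v) \<Rightarrow> bool"
where
  "irreducible_representation A s V \<rho> \<longleftrightarrow>
     representation A s V \<rho> \<and> V \<noteq> {0} \<and>
     (\<forall>W. module.subspace s W \<and> W \<subseteq> V \<and> (\<forall>a\<in>carrier A. \<forall>w\<in>W. \<rho> a w \<in> W)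
        \<longrightarrow> W = {0} \<or> W = V)"

section \<open>The algebra \<open>U\<^sub>q\<^sup>t\<^sup>w(so\<^sub>3)\<close>\<close>

definition qpow :: "complex \<Rightarrow> complex \<Rightarrow> complex" where
  "qpow h b = exp (h * b)"

definition qnum :: "complex \<Rightarrow> complex \<Rightarrow> complex" where
  "qnum h b = (qpow h b - qpow h (- b)) / (qpow h 1 - qpow h (- 1))"

datatype gen = G21 | G32

definition I21 :: "gen free" where "I21 = ket (Word [G21])"

definition I32 :: "gen free" where "I32 = ket (Word [G32])"

definition so3_relators :: "complex \<Rightarrow> gen free set" where
  "so3_relators h =
     {I32 * I32 * I21 - scl (qnum h 2) (I32 * I21 * I32) + I21 * I32 * I32 - (- I21),
      I21 * I21 * I32 - scl (qnum h 2) (I21 * I32 * I21) + I32 * I21 * I21 - (- I32)}"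

definition Uq_tw_so3 :: "complex \<Rightarrow> (complex, gen free set) module" where
  "Uq_tw_so3 h = presented_alg (so3_relators h)"

section \<open>The representation on \<open>V\<close>\<close>

definition zcoset :: "complex \<Rightarrow> complex set" where
  "zcoset m0 = {m0 + of_int k | k. True}"

definition V_space :: "complex \<Rightarrow> (complex \<Rightarrow>\<^sub>0 complex) set" where
  "V_space m0 = {v. Poly_Mapping.keys v \<subseteq> zcoset m0}"

fun gen_ket :: "complex \<Rightarrow> complex \<Rightarrow> gen \<Rightarrow> complex \<Rightarrow> (complex \<Rightarrow>\<^sub>0 complex)" where
  "gen_ket h l G21 m = scl (\<i> * qnum h m) (ket m)"
| "gen_ket h l G32 m =
     scl (qnum h (l + m + 1) * qnum h (l - m) /
          ((qpow h m + qpow h (- m)) * (qpow h (m + 1) + qpow h (- m - 1)))) (ket (m + 1))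
     - ket (m - 1)"

definition word_act ::
  "complex \<Rightarrow> complex \<Rightarrow> gen word \<Rightarrow> (complex \<Rightarrow>\<^sub>0 complex) \<Rightarrow> (complex \<Rightarrow>\<^sub>0 complex)" where
  "word_act h l w v = foldr (\<lambda>g. lin_ext (gen_ket h l g)) (letters w) v"

definition free_act ::
  "complex \<Rightarrow> complex \<Rightarrow> gen free \<Rightarrow> (complex \<Rightarrow>\<^sub>0 complex) \<Rightarrow> (complex \<Rightarrow>\<^sub>0 complex)" where
  "free_act h l p v = lin_ext (\<lambda>w. word_act h l w v) p"

text \<open>An element of \<open>Uq_tw_so3 h\<close> is a coset \<open>X\<close> of the relation ideal; it acts as any of
  its members does. For \<open>v\<close> in \<open>V_space m0\<close>, with \<open>q\<^sup>2\<^sup>m \<noteq> -1\<close> on \<open>zcoset m0\<close>, the set below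
  is a singleton because the operators \<open>lin_ext (gen_ket h l g)\<close> satisfy the relations there.\<close>

definition V_act ::
  "complex \<Rightarrow> complex \<Rightarrow> gen free set \<Rightarrow> (complex \<Rightarrow>\<^sub>0 complex) \<Rightarrow> (complex \<Rightarrow>\<^sub>0 complex)" where
  "V_act h l X v = the_elem ((\<lambda>p. free_act h l p v) ` X)"

end

theory Submission
  imports Defs "HOL-Analysis.Complex_Transcendental"
begin

text \<open>The generator \<open>I21\<close> is diagonal on kets, with eigenvalue \<open>\<i> [m]\<close> at the weight \<open>m\<close>. Since \<open>q\<close>
  is not a root of unity and \<open>q\<close> to the power \<open>m + n\<close> is never \<open>-1\<close> for weights \<open>m\<close> and \<open>n\<close> in
  \<open>zcoset m0\<close>, these eigenvalues are distinct (\<open>qnum_inj_on_zcoset\<close>). A subspace stable under \<open>I21\<close>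
  therefore contains the ket of every weight in the support of each of its vectors
  (\<open>ket_in_diagonal_invariant_subspace\<close>). The generator \<open>I32\<close> sends a ket to a combination of its
  two neighbours. The lower coefficient is \<open>-1\<close>, and the upper one is nonzero exactly because
  \<open>[l + m + 1]\<close> and \<open>[l - m]\<close> are. So one ket in a subrepresentation brings both neighbours with it,
  hence all kets.

  That there is a representation at all is the longer part. The free algebra acts by linear
  operators, multiplicatively (\<open>free_act_mult\<close>). On each ket with weight in \<open>zcoset m0\<close>
  the two relators vanish (\<open>relator_32_32_21_ket\<close>, \<open>relator_21_21_32_ket\<close>); this comes down to
  identities between quantum numbers, and to nonvanishing denominators. The annihilator of
  \<open>V_space m0\<close> is an ideal and so contains the relation ideal
  (\<open>relation_ideal_acts_trivially\<close>). Each coset then acts on \<open>V_space m0\<close> through any of its members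
  (\<open>V_act_class\<close>), and the axioms of a representation descend from the free algebra.\<close>

section \<open>Linear maps between formal linear combinations\<close>

lemma lookup_scl [simp]: "Poly_Mapping.lookup (scl c v) k = c * Poly_Mapping.lookup v k"
  by (simp add: scl_def map.rep_eq when_def)

lemma vector_space_scl: "vector_space scl"
  by unfold_locales (auto intro!: poly_mapping_eqI simp: lookup_add algebra_simps)

lemma module_scl: "Modules.module scl"
  using vector_space_scl by (simp add: module_iff_vector_space)

lemmas scl_simps [simp] =
  Modules.module.scale_scale [OF module_scl]
  Modules.module.scale_one [OF module_scl]
  Modules.module.scale_zero_left [OF module_scl]
  Modules.module.scale_zero_right [OF module_scl]

abbreviation linear_map :: "(('k \<Rightarrow>\<^sub>0 complex) \<Rightarrow> ('j \<Rightarrow>\<^sub>0 complex)) \<Rightarrow> bool" where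
  "linear_map \<equiv> module_hom scl scl"

lemma linear_mapI:
  assumes "\<And>v w. F (v + w) = F v + F w" "\<And>c v. F (scl c v) = scl c (F v)"
  shows "linear_map F"
  using assms by (simp add: module_hom_iff module_scl)

lemma ket_expansion: "v = (\<Sum>k\<in>Poly_Mapping.keys v. scl (Poly_Mapping.lookup v k) (ket k))"
  by (rule poly_mapping_eqI)
    (simp add: lookup_sum lookup_single when_def in_keys_iff if_distrib [of "\<lambda>x. _ * x"] cong: if_cong)

text \<open>A linear map is determined by its values on kets. Because only the kets in the support of the
  vector matter, this also serves for identities that hold merely on \<open>V_space m0\<close>, and, with
  words in place of weights, for identities in the free algebra.\<close>

lemma linear_map_eqI:
  assumes F: "linear_map F" and G: "linear_map G"
    and eq: "\<And>k. k \<in> Poly_Mapping.keys v \<Longrightarrow> F (ket k) = G (ket k)"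
  shows "F v = G v"
proof -
  have *: "H v = (\<Sum>k\<in>Poly_Mapping.keys v. scl (Poly_Mapping.lookup v k) (H (ket k)))"
    if H: "linear_map H" for H :: "('a \<Rightarrow>\<^sub>0 complex) \<Rightarrow> ('b \<Rightarrow>\<^sub>0 complex)"
    using arg_cong [OF ket_expansion [of v], of H]
    by (simp only: module_hom.sum [OF H] module_hom.scale [OF H])
  show ?thesis
    unfolding * [OF F] * [OF G] by (rule sum.cong) (simp_all only: eq)
qed

text \<open>The sum defining \<open>lin_ext\<close> runs over the support of its argument. Additivity compares three
  supports, so all three sums are first taken over one common finite set.\<close>

lemma lin_ext_superset:
  assumes "finite K" "Poly_Mapping.keys v \<subseteq> K"
  shows "lin_ext f v = (\<Sum>k\<in>K. scl (Poly_Mapping.lookup v k) (f k))"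
  unfolding lin_ext_def using assms
  by (intro sum.mono_neutral_left) (auto simp: in_keys_iff)

lemma linear_lin_ext: "linear_map (lin_ext f)"
proof (rule linear_mapI)
  fix v w :: "'a \<Rightarrow>\<^sub>0 complex" and c
  let ?K = "Poly_Mapping.keys v \<union> Poly_Mapping.keys w"
  have "lin_ext f (v + w) = (\<Sum>k\<in>?K. scl (Poly_Mapping.lookup (v + w) k) (f k))"
    using keys_add [of v w] by (intro lin_ext_superset) auto
  then show "lin_ext f (v + w) = lin_ext f v + lin_ext f w"
    by (simp add: lin_ext_superset [of ?K] lookup_add sum.distrib
        Modules.module.scale_left_distrib [OF module_scl])
  have "lin_ext f (scl c v) = (\<Sum>k\<in>Poly_Mapping.keys v. scl (Poly_Mapping.lookup (scl c v) k) (f k))"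
    by (intro lin_ext_superset) (auto simp: in_keys_iff)
  then show "lin_ext f (scl c v) = scl c (lin_ext f v)"
    by (simp add: lin_ext_def Modules.module.scale_sum_right [OF module_scl])
qed

lemma lin_ext_ket [simp]: "lin_ext f (ket k) = f k"
  by (simp add: lin_ext_def)

lemma lin_ext_in_subspace:
  assumes "module.subspace scl W" and "\<And>k. k \<in> Poly_Mapping.keys v \<Longrightarrow> f k \<in> W"
  shows "lin_ext f v \<in> W"
  unfolding lin_ext_def using assms
  by (intro Modules.module.subspace_sum [OF module_scl]
      Modules.module.subspace_scale [OF module_scl]) auto

section \<open>The action of the free algebra\<close>

lemma linear_word_act: "linear_map (word_act h l w)"
proof -
  have "linear_map (foldr (\<lambda>g. lin_ext (gen_ket h l g)) gs)" for gs
    by (induction gs)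
      (auto intro: linear_mapI simp: module_hom.add [OF linear_lin_ext]
        module_hom.scale [OF linear_lin_ext] module_hom.add module_hom.scale)
  then show ?thesis by (simp add: word_act_def [abs_def])
qed

lemma linear_free_act_left: "linear_map (\<lambda>p. free_act h l p v)"
  unfolding free_act_def by (rule linear_lin_ext)

lemma linear_free_act: "linear_map (free_act h l p)"
  by (rule linear_mapI)
    (simp_all add: free_act_def lin_ext_def module_hom.add [OF linear_word_act]
      module_hom.scale [OF linear_word_act] sum.distrib mult.commute
      Modules.module.scale_right_distrib [OF module_scl]
      Modules.module.scale_sum_right [OF module_scl])

lemma free_act_ket [simp]: "free_act h l (ket w) v = word_act h l w v"
  by (simp add: free_act_def)

lemma free_act_generator [simp]:
  "free_act h l I21 v = lin_ext (gen_ket h l G21) v"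
  "free_act h l I32 v = lin_ext (gen_ket h l G32) v"
  by (simp_all add: I21_def I32_def word_act_def)

lemma scl_conv_mult: "scl c p = Poly_Mapping.single 0 c * (p :: 'g free)"
  by (simp add: scl_def mult_map_scale_conv_mult)

lemma scl_mult_left: "scl c p * q = scl c (p * q :: 'g free)"
  by (simp add: scl_conv_mult mult.assoc)

text \<open>For a word on the left this is the neutrality of the empty word; for a general left factor it
  would be the centrality of scalars in the free algebra.\<close>

lemma ket_mult_scl: "ket w * scl c q = scl c (ket w * q :: 'g free)"
  by (simp add: scl_conv_mult mult.assoc [symmetric] mult_single)

lemma free_act_one: "free_act h l 1 v = v"
  by (simp flip: single_one add: word_act_def zero_word_def)

text \<open>Both sides are linear in \<open>p\<close> and in \<open>q\<close>, so it suffices to take words for both. A product of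
  words is a concatenation, which acts by composition.\<close>

lemma free_act_mult: "free_act h l (p * q) v = free_act h l p (free_act h l q v)"
proof -
  have word: "free_act h l (ket w * q) v = free_act h l (ket w) (free_act h l q v)" for w
  proof (rule linear_map_eqI [of "\<lambda>q. free_act h l (ket w * q) v"
        "\<lambda>q. free_act h l (ket w) (free_act h l q v)"])
    show "linear_map (\<lambda>q. free_act h l (ket w * q) v)"
      by (rule linear_mapI)
        (simp_all add: distrib_left ket_mult_scl module_hom.add [OF linear_free_act_left]
          module_hom.scale [OF linear_free_act_left])
    show "linear_map (\<lambda>q. free_act h l (ket w) (free_act h l q v))"
      by (rule linear_mapI)
        (simp_all add: module_hom.add [OF linear_free_act_left]
          module_hom.scale [OF linear_free_act_left] module_hom.add [OF linear_word_act]
          module_hom.scale [OF linear_word_act])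
    show "free_act h l (ket w * ket u) v = free_act h l (ket w) (free_act h l (ket u) v)" for u
      by (simp add: mult_single word_act_def plus_word_def)
  qed
  show ?thesis
  proof (rule linear_map_eqI [of "\<lambda>p. free_act h l (p * q) v"
        "\<lambda>p. free_act h l p (free_act h l q v)"])
    show "linear_map (\<lambda>p. free_act h l (p * q) v)"
      by (rule linear_mapI)
        (simp_all add: distrib_right scl_mult_left module_hom.add [OF linear_free_act_left]
          module_hom.scale [OF linear_free_act_left])
  qed (simp_all only: linear_free_act_left word)
qed

lemma subspace_V_space: "module.subspace scl (V_space m0)"
proof -
  have "Poly_Mapping.keys (v + w) \<subseteq> zcoset m0"
    if "Poly_Mapping.keys v \<subseteq> zcoset m0" "Poly_Mapping.keys w \<subseteq> zcoset m0" for v w :: "complex \<Rightarrow>\<^sub>0 complex"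
    using that keys_add [of v w] by blast
  moreover have "Poly_Mapping.keys (scl c v) \<subseteq> zcoset m0"
    if "Poly_Mapping.keys v \<subseteq> zcoset m0" for c and v :: "complex \<Rightarrow>\<^sub>0 complex"
    using that by (auto simp: in_keys_iff subset_iff)
  ultimately show ?thesis
    by (simp add: V_space_def Modules.module.subspace_def [OF module_scl])
qed

lemma ket_in_V_space: "ket m \<in> V_space m0 \<longleftrightarrow> m \<in> zcoset m0"
  by (simp add: V_space_def)

lemma zcoset_shift [intro]:
  assumes "m \<in> zcoset m0"
  shows "m + 1 \<in> zcoset m0" "m - 1 \<in> zcoset m0"
proof -
  obtain k :: int where "m = m0 + of_int k"
    using assms by (auto simp: zcoset_def)
  then have "m + 1 = m0 + of_int (k + 1)" "m - 1 = m0 + of_int (k - 1)"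
    by simp_all
  then show "m + 1 \<in> zcoset m0" "m - 1 \<in> zcoset m0"
    unfolding zcoset_def by blast+
qed

lemma gen_ket_in_V_space:
  assumes "m \<in> zcoset m0"
  shows "gen_ket h l g m \<in> V_space m0"
  using zcoset_shift [OF assms] assms
  by (cases g)
    (simp_all add: ket_in_V_space subspace_V_space Modules.module.subspace_diff [OF module_scl]
      Modules.module.subspace_scale [OF module_scl])

lemma free_act_in_V_space:
  assumes "v \<in> V_space m0"
  shows "free_act h l p v \<in> V_space m0"
proof -
  have gen: "lin_ext (gen_ket h l g) u \<in> V_space m0" if "u \<in> V_space m0" for g u
    using that
    by (intro lin_ext_in_subspace subspace_V_space gen_ket_in_V_space) (auto simp: V_space_def)
  have "foldr (\<lambda>g. lin_ext (gen_ket h l g)) gs v \<in> V_space m0" for gs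
    by (induction gs) (simp_all add: assms gen)
  then show ?thesis
    unfolding free_act_def word_act_def by (intro lin_ext_in_subspace subspace_V_space)
qed

section \<open>Quantum numbers\<close>

lemma qpow_add: "qpow h (a + b) = qpow h a * qpow h b"
  by (simp add: qpow_def distrib_left exp_add)

lemma qpow_minus: "qpow h (- a) = inverse (qpow h a)"
  by (simp add: qpow_def exp_minus)

lemma qpow_nonzero [simp]: "qpow h a \<noteq> 0"
  by (simp add: qpow_def)

lemma qpow_of_int_eq_1:
  assumes "h \<notin> {2 * of_real pi * \<i> * r | r. r \<in> \<rat>}" and "qpow h (of_int k) = 1"
  shows "k = 0"
proof (rule ccontr)
  assume "k \<noteq> 0"
  obtain n :: int where n: "Re (h * of_int k) = 0" "Im (h * of_int k) = of_int (2 * n) * pi"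
    using assms(2) unfolding qpow_def exp_eq_1 by blast
  have "h * of_int k = of_int (2 * n) * of_real pi * \<i>"
    using n by (intro complex_eqI) auto
  then have "h = 2 * of_real pi * \<i> * (of_int n / of_int k)"
    using \<open>k \<noteq> 0\<close> by (simp add: field_simps)
  moreover have "of_int n / of_int k \<in> (\<rat> :: complex set)"
    by simp
  ultimately show False
    using assms(1) by blast
qed

lemma q_minus_q_inverse_nonzero:
  assumes "h \<notin> {2 * of_real pi * \<i> * r | r. r \<in> \<rat>}"
  shows "qpow h 1 - qpow h (- 1) \<noteq> 0"
proof
  assume "qpow h 1 - qpow h (- 1) = 0"
  then have "qpow h 1 * qpow h 1 = 1"
    by (simp add: qpow_minus field_simps)
  then have "qpow h (of_int 2) = 1"
    using qpow_add [of h 1 1] by simp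
  then show False
    using qpow_of_int_eq_1 [OF assms, of 2] by simp
qed

text \<open>Multiplied by \<open>q - q\<inverse>\<close>, the difference \<open>[m] - [n]\<close> is
  \<open>(q\<^sup>m - q\<^sup>n) (1 + q\<^sup>-\<^sup>m\<^sup>-\<^sup>n)\<close>.\<close>

lemma qnum_eq_iff:
  assumes h: "h \<notin> {2 * of_real pi * \<i> * r | r. r \<in> \<rat>}"
  shows "qnum h m = qnum h n \<longleftrightarrow> qpow h m = qpow h n \<or> qpow h (m + n) = -1"
proof -
  have "qnum h m = qnum h n \<longleftrightarrow> qpow h m - qpow h (- m) = qpow h n - qpow h (- n)"
    using q_minus_q_inverse_nonzero [OF h] by (simp add: qnum_def)
  also have "\<dots> \<longleftrightarrow> (qpow h m - qpow h n) * (qpow h m * qpow h n + 1) = 0"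
    by (simp add: qpow_minus field_simps)
  also have "\<dots> \<longleftrightarrow> qpow h m = qpow h n \<or> qpow h (m + n) = -1"
    by (simp add: qpow_add add_eq_0_iff2)
  finally show ?thesis .
qed

text \<open>The weights in \<open>zcoset m0\<close> are thus separated by \<open>I21\<close>: for distinct weights one
  factor of \<open>[m] - [n]\<close> is nonzero since \<open>q\<close> is not a root of unity, the other since \<open>m + n\<close> differs
  from \<open>2 m0\<close> by an integer.\<close>

lemma qnum_inj_on_zcoset:
  assumes h: "h \<notin> {2 * of_real pi * \<i> * r | r. r \<in> \<rat>}"
    and m0: "\<forall>k::int. qpow h (2 * m0 + of_int k) \<noteq> - 1"
  shows "inj_on (qnum h) (zcoset m0)"
proof (rule inj_onI)
  fix m n
  assume "m \<in> zcoset m0" "n \<in> zcoset m0" and eq: "qnum h m = qnum h n"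
  then obtain j k :: int where mn: "m = m0 + of_int j" "n = m0 + of_int k"
    by (auto simp: zcoset_def)
  have "m + n = 2 * m0 + of_int (j + k)"
    by (simp add: mn)
  with m0 have "qpow h (m + n) \<noteq> -1"
    by metis
  then have "qpow h m = qpow h n"
    using eq by (simp add: qnum_eq_iff [OF h])
  then have "qpow h (of_int (j - k)) = 1"
    using qpow_add [of h "of_int (j - k)" n] by (simp add: mn add.commute)
  from qpow_of_int_eq_1 [OF h this] show "m = n"
    by (simp add: mn)
qed

lemma qpow_diff: "qpow h (a - b) = qpow h a / qpow h b"
  by (simp add: qpow_def right_diff_distrib exp_diff)

lemma qnum_2:
  assumes "qpow h 1 - qpow h (- 1) \<noteq> 0"
  shows "qnum h 2 = qpow h 1 + qpow h (- 1)"
  using assms qpow_add [of h 1 1] by (simp add: qnum_def qpow_minus field_simps)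

lemma qnum_times:
  assumes "qpow h 1 - qpow h (- 1) \<noteq> 0"
  shows "(qpow h 1 - qpow h (- 1)) * qnum h m = qpow h m - qpow h (- m)"
  using assms by (simp add: qnum_def)

lemma qnum_succ_minus_pred:
  assumes "qpow h 1 - qpow h (- 1) \<noteq> 0"
  shows "qnum h (m + 1) - qnum h (m - 1) = qpow h m + qpow h (- m)"
proof -
  have "(qpow h 1 - qpow h (- 1)) * (qnum h (m + 1) - qnum h (m - 1))
      = (qpow h 1 - qpow h (- 1)) * (qpow h m + qpow h (- m))"
    unfolding right_diff_distrib qnum_times [OF assms]
    by (simp add: qpow_add qpow_diff qpow_minus field_simps)
  then show ?thesis
    using assms by simp
qed

lemma qnum_succ_plus_pred:
  assumes "qpow h 1 - qpow h (- 1) \<noteq> 0"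
  shows "qnum h (m + 1) + qnum h (m - 1) = qnum h 2 * qnum h m"
proof -
  have "(qpow h 1 - qpow h (- 1)) * (qnum h (m + 1) + qnum h (m - 1))
      = qnum h 2 * ((qpow h 1 - qpow h (- 1)) * qnum h m)"
    unfolding distrib_left qnum_times [OF assms] qnum_2 [OF assms]
    by (simp add: qpow_add qpow_diff qpow_minus field_simps)
  then show ?thesis
    using assms by simp
qed

text \<open>The quantum deformation of \<open>(m + 1)\<^sup>2 - 2 m (m + 1) + m\<^sup>2 = 1\<close>. It is exactly what the
  relation quadratic in \<open>I21\<close> demands between neighbouring weights.\<close>

lemma qnum_quadratic:
  assumes "qpow h 1 - qpow h (- 1) \<noteq> 0"
  shows "(qnum h (m + 1))\<^sup>2 - qnum h 2 * qnum h m * qnum h (m + 1) + (qnum h m)\<^sup>2 = 1"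
proof -
  let ?s = "qpow h 1 - qpow h (- 1)"
  have "?s\<^sup>2 * ((qnum h (m + 1))\<^sup>2 - qnum h 2 * qnum h m * qnum h (m + 1) + (qnum h m)\<^sup>2)
      = (?s * qnum h (m + 1))\<^sup>2 - qnum h 2 * (?s * qnum h m) * (?s * qnum h (m + 1)) + (?s * qnum h m)\<^sup>2"
    by (simp add: algebra_simps power2_eq_square)
  also have "\<dots> = ?s\<^sup>2 * 1"
    unfolding qnum_times [OF assms] qnum_2 [OF assms]
    by (simp add: qpow_add qpow_diff qpow_minus field_simps power2_eq_square)
  finally show ?thesis
    using assms by (metis mult_cancel_left power_not_zero)
qed

text \<open>Multiplied by \<open>(q - q\<inverse>)\<^sup>2\<close>, a product \<open>[a] [b]\<close> splits into terms in \<open>a + b\<close> and terms in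
  \<open>a - b\<close>. Both products here have \<open>a + b = 2 l + 1\<close>, so \<open>l\<close> drops out of their difference.\<close>

lemma qnum_product_diff:
  assumes "qpow h 1 - qpow h (- 1) \<noteq> 0"
  shows "qnum h (l + m + 1) * qnum h (l - m) - qnum h (l + m) * qnum h (l - m + 1)
      = - qnum h m * (qpow h m + qpow h (- m))"
proof -
  let ?s = "qpow h 1 - qpow h (- 1)"
  have "?s\<^sup>2 * (qnum h (l + m + 1) * qnum h (l - m) - qnum h (l + m) * qnum h (l - m + 1))
      = (?s * qnum h (l + m + 1)) * (?s * qnum h (l - m))
        - (?s * qnum h (l + m)) * (?s * qnum h (l - m + 1))"
    by (simp add: algebra_simps power2_eq_square)
  also have "\<dots> = - ?s * (?s * qnum h m) * (qpow h m + qpow h (- m))"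
    unfolding qnum_times [OF assms] 
    by (simp add: qpow_add qpow_diff qpow_minus field_simps)
  also have "\<dots> = ?s\<^sup>2 * (- qnum h m * (qpow h m + qpow h (- m)))"
    by (simp add: algebra_simps power2_eq_square)
  finally show ?thesis
    using assms by (metis mult_cancel_left power_not_zero)
qed

section \<open>The defining relations on kets\<close>

definition weight_denom :: "complex \<Rightarrow> complex \<Rightarrow> complex" where
  "weight_denom h m = qpow h m + qpow h (- m)"

definition raise_coeff :: "complex \<Rightarrow> complex \<Rightarrow> complex \<Rightarrow> complex" where
  "raise_coeff h l m =
     qnum h (l + m + 1) * qnum h (l - m) / (weight_denom h m * weight_denom h (m + 1))"

lemma gen_ket_G32: "gen_ket h l G32 m = scl (raise_coeff h l m) (ket (m + 1)) - ket (m - 1)"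
  by (simp add: raise_coeff_def weight_denom_def)

lemma weight_denom_nonzero:
  assumes m0: "\<forall>k::int. qpow h (2 * m0 + of_int k) \<noteq> - 1" and m: "m \<in> zcoset m0"
  shows "weight_denom h m \<noteq> 0"
proof
  assume "weight_denom h m = 0"
  then have "qpow h m * qpow h m = - 1"
    by (simp add: weight_denom_def qpow_minus field_simps eq_neg_iff_add_eq_0)
  then have "qpow h (m + m) = - 1"
    by (simp only: qpow_add)
  moreover obtain k :: int where "m = m0 + of_int k"
    using m by (auto simp: zcoset_def)
  then have "m + m = 2 * m0 + of_int (2 * k)"
    by simp
  ultimately show False
    using m0 by metis
qed

text \<open>What the relation quadratic in \<open>I32\<close> demands at the weight \<open>m\<close>. On the left the outer
  denominators cancel, and the common one, at \<open>m\<close>, divides a difference of numerators.\<close>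

lemma raise_coeff_recurrence:
  assumes q: "qpow h 1 - qpow h (- 1) \<noteq> 0"
    and d: "weight_denom h (m - 1) \<noteq> 0" "weight_denom h m \<noteq> 0" "weight_denom h (m + 1) \<noteq> 0"
  shows "raise_coeff h l m * weight_denom h (m + 1)
      - raise_coeff h l (m - 1) * weight_denom h (m - 1) = - qnum h m"
proof -
  have "raise_coeff h l m * weight_denom h (m + 1)
      = qnum h (l + m + 1) * qnum h (l - m) / weight_denom h m"
    using d by (simp add: raise_coeff_def)
  moreover have "raise_coeff h l (m - 1) * weight_denom h (m - 1)
      = qnum h (l + m) * qnum h (l - m + 1) / weight_denom h m"
    using d by (simp add: raise_coeff_def algebra_simps)
  ultimately show ?thesis
    using d(2) qnum_product_diff [OF q, of l m]
    by (simp add: diff_divide_distrib [symmetric] weight_denom_def)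
qed

lemmas free_act_simps =
  free_act_mult free_act_generator
  module_hom.add [OF linear_free_act_left] module_hom.diff [OF linear_free_act_left]
  module_hom.neg [OF linear_free_act_left] module_hom.scale [OF linear_free_act_left]

lemmas lin_ext_simps =
  module_hom.add [OF linear_lin_ext] module_hom.diff [OF linear_lin_ext]
  module_hom.neg [OF linear_lin_ext] module_hom.scale [OF linear_lin_ext]

text \<open>Only the kets at distance \<open>2\<close> and \<open>0\<close> occur. The coefficients at \<open>m + 2\<close> and \<open>m - 2\<close> vanish by
  the three-term recurrence of \<open>[m]\<close>; the one at \<open>m\<close> is the
  recurrence for the raising coefficients.\<close>

lemma relator_32_32_21_ket:
  assumes q: "qpow h 1 - qpow h (- 1) \<noteq> 0"
    and d: "weight_denom h (m - 1) \<noteq> 0" "weight_denom h m \<noteq> 0" "weight_denom h (m + 1) \<noteq> 0"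
  shows "free_act h l
     (I32 * I32 * I21 - scl (qnum h 2) (I32 * I21 * I32) + I21 * I32 * I32 - (- I21)) (ket m) = 0"
    (is "free_act h l ?r _ = 0")
proof (rule poly_mapping_eqI)
  fix k :: complex
  let ?A = "raise_coeff h l" and ?e = "\<lambda>n. Poly_Mapping.lookup (ket n) k :: complex"
  have shift: "m + 1 + 1 = m + 2" "m - 1 - 1 = m - 2"
    by simp_all
  have up: "qnum h (m + 2) + qnum h m = qnum h 2 * qnum h (m + 1)"
    using qnum_succ_plus_pred [OF q, of "m + 1"] by (simp add: shift)
  have down: "qnum h m + qnum h (m - 2) = qnum h 2 * qnum h (m - 1)"
    using qnum_succ_plus_pred [OF q, of "m - 1"] by (simp add: shift)
  have step: "qnum h (m + 2) - qnum h m = weight_denom h (m + 1)"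
    "qnum h m - qnum h (m - 2) = weight_denom h (m - 1)"
    using qnum_succ_minus_pred [OF q, of "m + 1"] qnum_succ_minus_pred [OF q, of "m - 1"]
    by (simp_all add: weight_denom_def shift)
  have "Poly_Mapping.lookup (free_act h l ?r (ket m)) k
     = \<i> * (?A m * ?A (m + 1)) * (qnum h (m + 2) + qnum h m - qnum h 2 * qnum h (m + 1)) * ?e (m + 2)
       + \<i> * (?A m * (qnum h 2 * qnum h (m + 1) - 2 * qnum h m)
           + ?A (m - 1) * (qnum h 2 * qnum h (m - 1) - 2 * qnum h m) + qnum h m) * ?e m
       + \<i> * (qnum h m + qnum h (m - 2) - qnum h 2 * qnum h (m - 1)) * ?e (m - 2)"
    by (simp add: free_act_simps lin_ext_simps gen_ket_G32 shift lookup_minus lookup_add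
        del: gen_ket.simps(2)) (simp add: algebra_simps)
  also have "?A m * (qnum h 2 * qnum h (m + 1) - 2 * qnum h m)
      + ?A (m - 1) * (qnum h 2 * qnum h (m - 1) - 2 * qnum h m) + qnum h m
     = ?A m * weight_denom h (m + 1) - ?A (m - 1) * weight_denom h (m - 1) + qnum h m"
    unfolding up [symmetric] down [symmetric] step [symmetric] by (simp add: algebra_simps)
  finally show "Poly_Mapping.lookup (free_act h l ?r (ket m)) k = Poly_Mapping.lookup 0 k"
    by (simp add: raise_coeff_recurrence [OF q d] up down)
qed

text \<open>Here \<open>I32\<close> enters once, so the coefficients at \<open>m + 1\<close> and \<open>m - 1\<close> decouple. Each is a
  multiple of the quadratic identity for a pair of neighbouring weights.\<close>

lemma relator_21_21_32_ket:
  assumes q: "qpow h 1 - qpow h (- 1) \<noteq> 0"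
  shows "free_act h l
     (I21 * I21 * I32 - scl (qnum h 2) (I21 * I32 * I21) + I32 * I21 * I21 - (- I32)) (ket m) = 0"
    (is "free_act h l ?r _ = 0")
proof (rule poly_mapping_eqI)
  fix k :: complex
  let ?A = "raise_coeff h l" and ?e = "\<lambda>n. Poly_Mapping.lookup (ket n) k :: complex"
  have up: "(qnum h (m + 1))\<^sup>2 - qnum h 2 * qnum h m * qnum h (m + 1) + (qnum h m)\<^sup>2 = 1"
    by (rule qnum_quadratic [OF q])
  have down: "(qnum h m)\<^sup>2 - qnum h 2 * qnum h (m - 1) * qnum h m + (qnum h (m - 1))\<^sup>2 = 1"
    using qnum_quadratic [OF q, of "m - 1"] by simp
  have "Poly_Mapping.lookup (free_act h l ?r (ket m)) k
     = - ?A m * ((qnum h (m + 1))\<^sup>2 - qnum h 2 * qnum h m * qnum h (m + 1) + (qnum h m)\<^sup>2 - 1) * ?e (m + 1)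
       + ((qnum h m)\<^sup>2 - qnum h 2 * qnum h (m - 1) * qnum h m + (qnum h (m - 1))\<^sup>2 - 1) * ?e (m - 1)"
    by (simp add: free_act_simps lin_ext_simps gen_ket_G32 lookup_minus lookup_add
        del: gen_ket.simps(2)) (simp add: algebra_simps power2_eq_square)
  then show "Poly_Mapping.lookup (free_act h l ?r (ket m)) k = Poly_Mapping.lookup 0 k"
    by (simp add: up down)
qed

section \<open>Descent to the quotient by the relation ideal\<close>

lemma free_alg_simps [simp]:
  "carrier free_alg = UNIV" "monoid.mult free_alg = (*)" "one free_alg = 1"
  "zero free_alg = 0" "add free_alg = (+)" "smult free_alg = scl"
  by (simp_all add: free_alg_def)

lemma ring_free_alg: "ring free_alg"
proof (rule ringI)
  show "abelian_group free_alg"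
    by (rule abelian_groupI) (auto simp: algebra_simps intro: exI [of _ "- _"])
  show "Group.monoid free_alg"
    by (rule monoidI) (auto simp: algebra_simps)
qed (auto simp: algebra_simps)

lemma a_inv_free_alg: "a_inv free_alg p = - p"
proof -
  interpret ring free_alg by (rule ring_free_alg)
  show ?thesis by (rule minus_equality) auto
qed

text \<open>Two-sidedness uses that \<open>V_space m0\<close> is stable: in \<open>j * p\<close> the right factor acts first and must
  stay within the space on which \<open>j\<close> vanishes.\<close>

lemma ideal_annihilator: "ideal {p. \<forall>v\<in>V_space m0. free_act h l p v = 0} free_alg"
  (is "ideal ?K _")
proof (rule idealI [OF ring_free_alg])
  interpret ring free_alg by (rule ring_free_alg)
  show "subgroup ?K (add_monoid free_alg)"
    by (rule add.subgroupI)
      (auto simp: a_inv_def [symmetric] a_inv_free_alg free_act_simps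
        module_hom.zero [OF linear_free_act_left] intro!: exI [of _ 0])
qed (auto simp: free_act_mult module_hom.zero [OF linear_free_act] free_act_in_V_space)

lemma Uq_ideal:
  "ideal (genideal free_alg (so3_relators h)) free_alg"
  "so3_relators h \<subseteq> genideal free_alg (so3_relators h)"
  using ring.genideal_ideal [OF ring_free_alg] ring.genideal_self [OF ring_free_alg] by auto

text \<open>The annihilator of \<open>V_space m0\<close> is a two-sided ideal containing the relators, hence it contains
  the ideal that they generate.\<close>

lemma relation_ideal_acts_trivially:
  assumes q: "qpow h 1 - qpow h (- 1) \<noteq> 0"
    and m0: "\<forall>k::int. qpow h (2 * m0 + of_int k) \<noteq> - 1"
    and j: "j \<in> genideal free_alg (so3_relators h)" and v: "v \<in> V_space m0"
  shows "free_act h l j v = 0"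
proof -
  have "free_act h l r w = 0" if "r \<in> so3_relators h" "w \<in> V_space m0" for r w
  proof (rule linear_map_eqI [OF linear_free_act])
    show "linear_map (\<lambda>w. 0)"
      by (rule linear_mapI) auto
    fix m assume "m \<in> Poly_Mapping.keys w"
    then have "m \<in> zcoset m0"
      using that by (auto simp: V_space_def)
    then show "free_act h l r (ket m) = 0"
      using that(1) relator_32_32_21_ket [OF q] relator_21_21_32_ket [OF q]
        weight_denom_nonzero [OF m0] zcoset_shift
      unfolding so3_relators_def by blast
  qed
  then have "genideal free_alg (so3_relators h) \<subseteq> {p. \<forall>v\<in>V_space m0. free_act h l p v = 0}"
    by (intro ring.genideal_minimal [OF ring_free_alg ideal_annihilator]) auto
  then show ?thesis
    using j v by auto
qed

lemma V_act_eqI: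
  assumes "X \<noteq> {}" and "\<And>p. p \<in> X \<Longrightarrow> free_act h l p v = u"
  shows "V_act h l X v = u"
proof -
  have "(\<lambda>p. free_act h l p v) ` X = {u}"
    using assms by auto
  then show ?thesis
    by (simp add: V_act_def)
qed

abbreviation Uq_class :: "complex \<Rightarrow> gen free \<Rightarrow> gen free set" where
  "Uq_class h p \<equiv> genideal free_alg (so3_relators h) +>\<^bsub>free_alg\<^esub> p"

lemma Uq_class_eq: "Uq_class h p = (\<lambda>j. j + p) ` genideal free_alg (so3_relators h)"
  by (auto simp: a_r_coset_def')

lemma Uq_class_self: "p \<in> Uq_class h p"
  using ideal.axioms(1) [OF Uq_ideal(1)] additive_subgroup.zero_closed [of _ free_alg]
  by (force simp: Uq_class_eq)

lemma Uq_tw_so3_simps: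
  "carrier (Uq_tw_so3 h) = range (Uq_class h)"
  "Uq_class h p \<oplus>\<^bsub>Uq_tw_so3 h\<^esub> Uq_class h p' = Uq_class h (p + p')"
  "Uq_class h p \<otimes>\<^bsub>Uq_tw_so3 h\<^esub> Uq_class h p' = Uq_class h (p * p')"
  "\<one>\<^bsub>Uq_tw_so3 h\<^esub> = Uq_class h 1"
  "c \<odot>\<^bsub>Uq_tw_so3 h\<^esub> X = (\<Union>x\<in>X. Uq_class h (scl c x))"
  using ideal.a_rcos_sum [OF Uq_ideal(1), of p p'] ideal.rcoset_mult_add [OF Uq_ideal(1), of p p']
  by (auto simp: Uq_tw_so3_def presented_alg_def quot_alg_def ring.defs module.defs FactRing_def
      A_RCOSETS_def')


text \<open>Two members of a class differ by an element of the relation ideal, which acts as zero.\<close>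

lemma V_act_class:
  assumes q: "qpow h 1 - qpow h (- 1) \<noteq> 0"
    and m0: "\<forall>k::int. qpow h (2 * m0 + of_int k) \<noteq> - 1"
    and v: "v \<in> V_space m0"
  shows "V_act h l (Uq_class h p) v = free_act h l p v"
proof (rule V_act_eqI)
  show "Uq_class h p \<noteq> {}"
    using Uq_class_self by blast
  show "free_act h l p' v = free_act h l p v" if "p' \<in> Uq_class h p" for p'
    using that relation_ideal_acts_trivially [OF q m0 _ v]
    by (auto simp: Uq_class_eq free_act_simps)
qed

text \<open>The scalar multiple of a class is formed as a union of classes of scaled members, so the action of
  every member of that union is computed, rather than that of a representative.\<close>

lemma V_act_smult:
  assumes q: "qpow h 1 - qpow h (- 1) \<noteq> 0"
    and m0: "\<forall>k::int. qpow h (2 * m0 + of_int k) \<noteq> - 1"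
    and v: "v \<in> V_space m0"
  shows "V_act h l (c \<odot>\<^bsub>Uq_tw_so3 h\<^esub> Uq_class h p) v = scl c (V_act h l (Uq_class h p) v)"
proof (rule V_act_eqI)
  show "c \<odot>\<^bsub>Uq_tw_so3 h\<^esub> Uq_class h p \<noteq> {}"
    using Uq_class_self by (fastforce simp: Uq_tw_so3_simps(5))
  show "free_act h l r v = scl c (V_act h l (Uq_class h p) v)"
    if "r \<in> c \<odot>\<^bsub>Uq_tw_so3 h\<^esub> Uq_class h p" for r
    using that relation_ideal_acts_trivially [OF q m0 _ v]
    by (auto simp: Uq_tw_so3_simps(5) Uq_class_eq free_act_simps V_act_class [OF q m0 v, unfolded Uq_class_eq])
qed

lemma representation_V_act:
  assumes q: "qpow h 1 - qpow h (- 1) \<noteq> 0"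
    and m0: "\<forall>k::int. qpow h (2 * m0 + of_int k) \<noteq> - 1"
  shows "representation (Uq_tw_so3 h) scl (V_space m0) (V_act h l)"
proof -
  note V = subspace_V_space [of m0]
  show ?thesis
    unfolding representation_def Uq_tw_so3_simps(1)
    by (simp add: vector_space_scl V V_act_smult [OF q m0] Uq_tw_so3_simps(2-4) V_act_class [OF q m0]
        free_act_in_V_space Modules.module.subspace_add [OF module_scl V]
        Modules.module.subspace_scale [OF module_scl V] free_act_simps free_act_one
        module_hom.add [OF linear_free_act] module_hom.scale [OF linear_free_act])
qed

section \<open>Irreducibility\<close>

text \<open>A subspace stable under a diagonal operator with distinct eigenvalues contains the components of
  its vectors: applying the product of the \<open>D - d j\<close> over all \<open>j \<noteq> k\<close> in the support leaves
  a nonzero multiple of \<open>ket k\<close>.\<close>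

lemma ket_in_diagonal_invariant_subspace:
  fixes d :: "'k \<Rightarrow> complex"
  assumes W: "module.subspace scl W" and D_W: "\<And>w. w \<in> W \<Longrightarrow> D w \<in> W"
    and D: "\<And>w n. Poly_Mapping.lookup (D w) n = d n * Poly_Mapping.lookup w n"
    and w: "w \<in> W" and inj: "inj_on d (Poly_Mapping.keys w)" and k: "k \<in> Poly_Mapping.keys w"
  shows "ket k \<in> W"
proof -
  have filter: "\<exists>u\<in>W. \<forall>n. Poly_Mapping.lookup u n = (\<Prod>j\<in>S. d n - d j) * Poly_Mapping.lookup w n"
    if "finite S" for S
    using that
  proof (induction S)
    case empty
    then show ?case using w by auto
  next
    case (insert j S)
    then obtain u where u: "u \<in> W"
      "\<And>n. Poly_Mapping.lookup u n = (\<Prod>j\<in>S. d n - d j) * Poly_Mapping.lookup w n"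
      by auto
    \<comment> \<open>The operator \<open>D - d j\<close> multiplies the component at \<open>n\<close> by \<open>d n - d j\<close>.\<close>
    have "D u - scl (d j) u \<in> W"
      using u(1) by (intro Modules.module.subspace_diff [OF module_scl W]
          Modules.module.subspace_scale [OF module_scl W] D_W)
    then show ?case
      using insert.hyps by (intro bexI [of _ "D u - scl (d j) u"])
        (auto simp: lookup_minus D u(2) algebra_simps)
  qed
  let ?S = "Poly_Mapping.keys w - {k}"
  obtain u where u: "u \<in> W"
    "\<And>n. Poly_Mapping.lookup u n = (\<Prod>j\<in>?S. d n - d j) * Poly_Mapping.lookup w n"
    using filter [of ?S] by auto
  let ?c = "Poly_Mapping.lookup u k"
  have "(\<Prod>j\<in>?S. d k - d j) \<noteq> 0"
    using inj_onD [OF inj _ k] by auto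
  then have c: "?c \<noteq> 0"
    using k by (simp add: u(2) in_keys_iff)
  have "Poly_Mapping.lookup u n = 0" if "n \<noteq> k" for n
    using that by (cases "n \<in> Poly_Mapping.keys w") (auto simp: u(2) in_keys_iff)
  then have "ket k = scl (1 / ?c) u"
    using c by (intro poly_mapping_eqI) (auto simp: lookup_single when_def)
  then show ?thesis
    using u(1) Modules.module.subspace_scale [OF module_scl W] by simp
qed

lemma lookup_I21_act:
  "Poly_Mapping.lookup (lin_ext (gen_ket h l G21) v) n = \<i> * qnum h n * Poly_Mapping.lookup v n"
  by (simp add: lin_ext_def lookup_sum lookup_single when_def in_keys_iff
      if_distrib [of "\<lambda>x. _ * x"] cong: if_cong)

lemma zcoset_connected:
  assumes m: "m \<in> zcoset m0" "P m"
    and step: "\<And>n. n \<in> zcoset m0 \<Longrightarrow> P n \<Longrightarrow> P (n + 1) \<and> P (n - 1)"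
    and n: "n \<in> zcoset m0"
  shows "P n"
proof -
  obtain j k :: int where jk: "m = m0 + of_int j" "n = m0 + of_int k"
    using m n by (auto simp: zcoset_def)
  have mem: "m0 + of_int i \<in> zcoset m0" for i :: int
    by (auto simp: zcoset_def)
  have "P (m0 + of_int k)"
  proof (induction k rule: int_induct [where k = j])
    case base
    then show ?case using m jk by simp
  next
    case (step1 i)
    then show ?case using step [OF mem, of i] by (simp add: add.assoc)
  next
    case (step2 i)
    then show ?case using step [OF mem, of i] by (simp add: add_diff_eq)
  qed
  then show ?thesis by (simp add: jk)
qed

lemma V_space_subset:
  assumes W: "module.subspace scl W" and kets: "\<And>m. m \<in> zcoset m0 \<Longrightarrow> ket m \<in> W"
  shows "V_space m0 \<subseteq> W"
proof
  fix v assume v: "v \<in> V_space m0"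
  have "(\<Sum>k\<in>Poly_Mapping.keys v. scl (Poly_Mapping.lookup v k) (ket k)) \<in> W"
    using v kets by (intro Modules.module.subspace_sum [OF module_scl W]
        Modules.module.subspace_scale [OF module_scl W]) (auto simp: V_space_def)
  then show "v \<in> W"
    by (simp only: ket_expansion [symmetric])
qed

theorem theorem3p3:
  fixes h m0 l :: complex
  assumes "h \<notin> {2 * of_real pi * \<i> * r | r. r \<in> \<rat>}"
    and "\<forall>k::int. qpow h (2 * m0 + of_int k) \<noteq> - 1"
    and "\<forall>m\<in>zcoset m0. qnum h (l + m + 1) \<noteq> 0 \<and> qnum h (l - m) \<noteq> 0"
  shows "irreducible_representation (Uq_tw_so3 h) scl (V_space m0) (V_act h l)"
  unfolding irreducible_representation_def
proof (intro conjI allI impI)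
  note q = q_minus_q_inverse_nonzero [OF assms(1)]
  show "representation (Uq_tw_so3 h) scl (V_space m0) (V_act h l)"
    by (rule representation_V_act [OF q assms(2)])
  have "m0 \<in> zcoset m0"
    by (auto simp: zcoset_def intro: exI [of _ 0])
  then have "ket m0 \<in> V_space m0"
    by (simp add: ket_in_V_space)
  moreover have "ket m0 \<noteq> (0 :: complex \<Rightarrow>\<^sub>0 complex)"
    by (metis lookup_single_eq lookup_zero zero_neq_one)
  ultimately show "V_space m0 \<noteq> {0}"
    by blast
  fix W
  assume asm: "module.subspace scl W \<and> W \<subseteq> V_space m0
    \<and> (\<forall>a\<in>carrier (Uq_tw_so3 h). \<forall>w\<in>W. V_act h l a w \<in> W)"
  then have W: "module.subspace scl W" and W_V: "W \<subseteq> V_space m0"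
    by auto
  have inv: "free_act h l p w \<in> W" if "w \<in> W" for p w
  proof -
    have "V_act h l (Uq_class h p) w \<in> W"
      using asm that by (simp add: Uq_tw_so3_simps(1))
    moreover have "w \<in> V_space m0"
      using that W_V by blast
    ultimately show ?thesis
      by (simp add: V_act_class [OF q assms(2)])
  qed
  have ket: "ket k \<in> W" if w: "w \<in> W" and k: "k \<in> Poly_Mapping.keys w" for w k
  proof (rule ket_in_diagonal_invariant_subspace [OF W _ lookup_I21_act w _ k])
    show "lin_ext (gen_ket h l G21) u \<in> W" if "u \<in> W" for u
      using inv [OF that, of I21] by simp
    show "inj_on (\<lambda>n. \<i> * qnum h n) (Poly_Mapping.keys w)"
      using inj_on_subset [OF qnum_inj_on_zcoset [OF assms(1,2)]] w W_V
      by (auto simp: inj_on_def V_space_def)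
  qed
  have step: "ket (m + 1) \<in> W \<and> ket (m - 1) \<in> W" if m: "m \<in> zcoset m0" and mW: "ket m \<in> W" for m
  proof -
    let ?w = "scl (raise_coeff h l m) (ket (m + 1)) - ket (m - 1)"
    have "?w \<in> W"
      using inv [OF mW, of I32] by (simp add: gen_ket_G32 del: gen_ket.simps)
    moreover have "raise_coeff h l m \<noteq> 0"
      using assms(3) m weight_denom_nonzero [OF assms(2)] zcoset_shift [OF m]
      by (simp add: raise_coeff_def)
    then have "m + 1 \<in> Poly_Mapping.keys ?w" "m - 1 \<in> Poly_Mapping.keys ?w"
      by (simp_all add: in_keys_iff lookup_minus lookup_single when_def diff_eq_eq)
    ultimately show ?thesis
      using ket by blast
  qed
  show "W = {0} \<or> W = V_space m0"
  proof (cases "W \<subseteq> {0}")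
    case True
    then show ?thesis
      using Modules.module.subspace_0 [OF module_scl W] by blast
  next
    case False
    then obtain w where w: "w \<in> W" "w \<noteq> 0"
      by blast
    then obtain m where m: "m \<in> Poly_Mapping.keys w"
      by (metis all_not_in_conv keys_eq_empty)
    have "m \<in> zcoset m0"
      using m w W_V by (auto simp: V_space_def)
    then have "ket n \<in> W" if "n \<in> zcoset m0" for n
      using zcoset_connected [of m m0 "\<lambda>n. ket n \<in> W"] ket [OF w(1) m] step that by blast
    then show ?thesis
      using V_space_subset [OF W] W_V by blast
  qed
qed

end
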